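(* Let $V=\oplus_{q\in\frac12\mathbb{Z}}V_{(q)}$ be a conformal vertex superalgebra such that $V_{(\frac32)}+V_{(2)}$ strongly generates $V$. Equip the subspace $V_{(2)}$ with the non-associative algebra structure $$ab=a_1b\quad\text{for }a,b\in V_{(2)}$$ and define a bilinear form $\langle\cdot,\cdot\rangle$ on $V_{(2)}$ by $$a_3b=\langle a,b\rangle\mathbf 1\quad\text{for }a,b\in V_{(2)}.$$ Then $V_{(2)}$ is commutative and $\frac12\omega$ is an identity, and the bilinear form $\langle\cdot,\cdot\rangle$ is symmetric. Furthermore, if in addition $a_0b\in L(-1)V_{(2)}$ for all $a,b\in V_{(2)}$, then the non-associative algebra $V_{(2)}$ is actually associative and the bilinear form is associative in the sense that $\langle ab,c\rangle=\langle a,bc\rangle$ for $a,b,c\in V_{(2)}$.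
   Context: A conformal vertex superalgebra is $(V,Y,\mathbf 1,\omega)$ with $V=\oplus_{q\in\frac12\mathbb{Z}}V_{(q)}\neq0$ a complex vector space with parity decomposition $V^{\bar0}=\oplus_{n\in\mathbb{Z}}V_{(n)}$, $V^{\bar1}=\oplus_{n\in\mathbb{Z}}V_{(n+\frac12)}$, a linear map $Y(v,z)=\sum_n v_nz^{-n-1}\in(\mathrm{End}\,V)[[z,z^{-1}]]$, and even vectors $\mathbf 1,\omega$, such that: $u_nv\in V^{\alpha+\beta}$ for $u\in V^\alpha,v\in V^\beta$ and $u_nv=0$ for $n$ large; for parity-homogeneous $u,v$ and $m,n,k\in\mathbb{Z}$, $\sum_{i\ge0}(-1)^i\binom mi(u_{m+k-i}v_{n+i}-(-1)^{|u||v|}(-1)^mv_{m+n-i}u_{k+i})=\sum_{i\ge0}\binom ki(u_{m+i}v)_{n+k-i}$ (Jacobi identity); $\mathbf 1_mv=\delta_{m,-1}v$, $v_{-1}\mathbf 1=v$, $v_n\mathbf 1=0$ for $n\ge0$; $L(n)=\omega_{n+1}$ satisfy $[L(m),L(n)]=(m-n)L(m+n)+\frac{m^3-m}{12}\delta_{m+n,0}c_V$ for some $c_V\in\mathbb{C}$; $Y(L(-1)v,z)=\frac{d}{dz}Y(v,z)$; and $V_{(q)}=\{v: L(0)v=qv\}$. No finite-dimensionality or lower truncation of the grading is assumed. $V$ is strongly generated by a subset $T$ if $V$ is spanned by $\mathbf 1$ and the vectors $a^{(1)}_{-n_1}\cdots a^{(r)}_{-n_r}\mathbf 1$ with $r\ge1$,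 $a^{(i)}\in T$, $n_i$ positive integers. For $V$ strongly generated by $V_{(\frac32)}+V_{(2)}$ one has $V_{(0)}=\mathbb{C}\mathbf 1$, so the form is well defined ($a_3b\in V_{(0)}$ and $a_1b\in V_{(2)}$). "Non-associative" means not necessarily associative. *)

theory Defs
  imports Complex_Main "HOL-Library.Groups_Big_Fun" "HOL-Library.Z2"
begin

text \<open>
  The vector space V is a whole type, with scalar multiplication \<open>scale\<close>. The field
  Y(v,z) = \<open>\<Sum>\<close> v_n z^(-n-1) is given by its modes: \<open>Y v n w\<close> is v_n w.
\<close>

type_synonym 'v modes = "'v \<Rightarrow> int \<Rightarrow> 'v \<Rightarrow> 'v"

definition virasoro :: "'v modes \<Rightarrow> 'v \<Rightarrow> int \<Rightarrow> 'v \<Rightarrow> 'v" where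
  "virasoro Y \<omega> n = Y \<omega> (n + 1)"

definition weight_space ::
    "(complex \<Rightarrow> 'v \<Rightarrow> 'v) \<Rightarrow> 'v modes \<Rightarrow> 'v \<Rightarrow> rat \<Rightarrow> 'v set" where
  "weight_space scale Y \<omega> q = {v. virasoro Y \<omega> 0 v = scale (of_rat q) v}"

definition half_integers :: "rat set" where
  "half_integers = range (\<lambda>k::int. of_int k / 2)"

text \<open>Every vector is, in exactly one way, a finite sum of vectors of the \<open>W i\<close>, \<open>i \<in> I\<close>.\<close>

definition is_direct_sum :: "'i set \<Rightarrow> ('i \<Rightarrow> 'v::comm_monoid_add set) \<Rightarrow> bool" where
  "is_direct_sum I W \<longleftrightarrow>
     (\<forall>v. \<exists>!f. (\<forall>i\<in>I. f i \<in> W i) \<and> (\<forall>i. i \<notin> I \<longrightarrow> f i = 0) \<and>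
               finite {i. f i \<noteq> 0} \<and> v = Sum_any f)"

text \<open>Parities are elements of Z/2, i.e. of type \<open>bit\<close>. The sum of subspaces is the span of
  their union.\<close>

definition parity_space ::
    "(complex \<Rightarrow> 'v::ab_group_add \<Rightarrow> 'v) \<Rightarrow> 'v modes \<Rightarrow> 'v \<Rightarrow> bit \<Rightarrow> 'v set" where
  "parity_space scale Y \<omega> \<alpha> =
     module.span scale
       (\<Union>n::int. weight_space scale Y \<omega> (if \<alpha> = 0 then of_int n else of_int n + 1/2))"

definition super_sign :: "bit \<Rightarrow> bit \<Rightarrow> complex" where
  "super_sign \<alpha> \<beta> = (if \<alpha> * \<beta> = 1 then -1 else 1)"

text \<open>
  The infinite sums in \<open>jacobi\<close> are taken with \<open>Sum_any\<close> after application to a vector \<open>w\<close>;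
  all of them have finite support by \<open>truncation\<close>. The axiom \<open>translation\<close> is
  Y(L(-1)v,z) = (d/dz) Y(v,z), read off at z^(-n-1).
\<close>

locale conformal_vertex_superalgebra = vector_space scale
  for scale :: "complex \<Rightarrow> 'v::ab_group_add \<Rightarrow> 'v" +
  fixes Y :: "'v modes" and vac :: 'v and \<omega> :: 'v
  assumes nonzero: "\<exists>v::'v. v \<noteq> 0"
    and mode_linear: "\<And>u n. Vector_Spaces.linear scale scale (Y u n)"
    and Y_linear: "\<And>n w. Vector_Spaces.linear scale scale (\<lambda>u. Y u n w)"
    and grading: "is_direct_sum half_integers (weight_space scale Y \<omega>)"
    and vac_even: "vac \<in> parity_space scale Y \<omega> 0"
    and conformal_even: "\<omega> \<in> parity_space scale Y \<omega> 0"
    and mode_parity: "\<And>\<alpha> \<beta> u v n. \<lbrakk>u \<in> parity_space scale Y \<omega> \<alpha>; v \<in> parity_space scale Y \<omega> \<beta>\<rbrakk>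
          \<Longrightarrow> Y u n v \<in> parity_space scale Y \<omega> (\<alpha> + \<beta>)"
    and truncation: "\<And>\<alpha> \<beta> u v. \<lbrakk>u \<in> parity_space scale Y \<omega> \<alpha>; v \<in> parity_space scale Y \<omega> \<beta>\<rbrakk>
          \<Longrightarrow> \<exists>N. \<forall>n\<ge>N. Y u n v = 0"
    and jacobi: "\<And>\<alpha> \<beta> u v w (m::int) (n::int) (k::int).
          \<lbrakk>u \<in> parity_space scale Y \<omega> \<alpha>; v \<in> parity_space scale Y \<omega> \<beta>\<rbrakk> \<Longrightarrow>
          Sum_any (\<lambda>i::nat. scale ((-1) ^ i * (of_int m gchoose i))
             (Y u (m + k - int i) (Y v (n + int i) w)
              - scale (super_sign \<alpha> \<beta> * (-1) powi m)
                  (Y v (m + n - int i) (Y u (k + int i) w))))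
          = Sum_any (\<lambda>i::nat. scale (of_int k gchoose i)
             (Y (Y u (m + int i) v) (n + k - int i) w))"
    and vac_mode: "\<And>m v. Y vac m v = (if m = -1 then v else 0)"
    and creation: "\<And>v. Y v (-1) vac = v"
    and creation_nonneg: "\<And>v n. n \<ge> 0 \<Longrightarrow> Y v n vac = 0"
    and virasoro_relations: "\<exists>c::complex. \<forall>m n v.
          virasoro Y \<omega> m (virasoro Y \<omega> n v) - virasoro Y \<omega> n (virasoro Y \<omega> m v)
          = scale (of_int (m - n)) (virasoro Y \<omega> (m + n) v)
            + scale (of_int (m ^ 3 - m) / 12 * (if m + n = 0 then 1 else 0) * c) v"
    and translation: "\<And>v n w. Y (virasoro Y \<omega> (-1) v) n w = scale (- of_int n) (Y v (n - 1) w)"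

text \<open>The empty list contributes the vacuum.\<close>

definition strongly_generates ::
    "(complex \<Rightarrow> 'v::ab_group_add \<Rightarrow> 'v) \<Rightarrow> 'v modes \<Rightarrow> 'v \<Rightarrow> 'v set \<Rightarrow> bool" where
  "strongly_generates scale Y vac T \<longleftrightarrow>
     module.span scale
       {foldr (\<lambda>(a, n). Y a (- n)) xs vac | xs :: ('v \<times> int) list.
          \<forall>(a, n)\<in>set xs. a \<in> T \<and> n > 0} = UNIV"

definition bilinear_on ::
    "(complex \<Rightarrow> 'v::ab_group_add \<Rightarrow> 'v) \<Rightarrow> (complex \<Rightarrow> 'w::ab_group_add \<Rightarrow> 'w) \<Rightarrow>
     'v set \<Rightarrow> ('v \<Rightarrow> 'v \<Rightarrow> 'w) \<Rightarrow> bool" where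
  "bilinear_on s t A f \<longleftrightarrow>
     (\<forall>a\<in>A. \<forall>b\<in>A. \<forall>c\<in>A. f (a + b) c = f a c + f b c \<and> f c (a + b) = f c a + f c b) \<and>
     (\<forall>r. \<forall>a\<in>A. \<forall>b\<in>A. f (s r a) b = t r (f a b) \<and> f a (s r b) = t r (f a b))"

definition nonassociative_algebra_on ::
    "(complex \<Rightarrow> 'v::ab_group_add \<Rightarrow> 'v) \<Rightarrow> 'v set \<Rightarrow> ('v \<Rightarrow> 'v \<Rightarrow> 'v) \<Rightarrow> bool" where
  "nonassociative_algebra_on s A f \<longleftrightarrow>
     module.subspace s A \<and> (\<forall>a\<in>A. \<forall>b\<in>A. f a b \<in> A) \<and> bilinear_on s s A f"

definition weight2_product :: "'v modes \<Rightarrow> 'v \<Rightarrow> 'v \<Rightarrow> 'v" where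
  "weight2_product Y a b = Y a 1 b"

definition weight2_form ::
    "(complex \<Rightarrow> 'v \<Rightarrow> 'v) \<Rightarrow> 'v modes \<Rightarrow> 'v \<Rightarrow> 'v \<Rightarrow> 'v \<Rightarrow> complex" where
  "weight2_form scale Y vac a b = (THE c. Y a 3 b = scale c vac)"

end

theory Submission imports Defs begin

text \<open>
  Write \<open>V_q\<close> for the space of weight \<open>q\<close>. A mode \<open>a_n\<close> with \<open>a \<in> V_p\<close> maps \<open>V_q\<close> to
  \<open>V_(p+q-n-1)\<close>, so each creation mode \<open>a_(-n)\<close>, \<open>n > 0\<close>, of a generator raises the weight by at
  least \<open>3/2\<close>. Hence strong generation forces \<open>V_0\<close> to be the line of the vacuum
  (\<open>weight_0\<close>) and \<open>V_n = 0\<close> for the other integers \<open>n \<le> 1\<close> (\<open>weight_gap\<close>). In particular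
  \<open>a_2 b = 0\<close>, \<open>a_3 b\<close> is a multiple of the vacuum, and \<open>a_n b = 0\<close> for \<open>n \<ge> 4\<close>, for all
  \<open>a, b \<in> V_2\<close>.

  Skew-symmetry expresses \<open>b_m a\<close> through \<open>a_m b, a_(m+1) b, \<dots>\<close>. For \<open>m = 1\<close> and \<open>m = 3\<close> every
  term after the first vanishes, either by the weight gap or because it is a mode of the vacuum
  applied to the vacuum; this is the commutativity of the product and the symmetry of the form.
  The identity comes from \<open>\<omega>_1 = L(0)\<close>, which is multiplication by \<open>2\<close> on \<open>V_2\<close>.

  Suppose now that \<open>a_0 b = L(-1)x\<close> with \<open>x \<in> V_2\<close>. Applying \<open>L(1)\<close>, which annihilates \<open>V_2\<close>
  since \<open>V_1 = 0\<close>, gives \<open>4x = 2 ab\<close>, so \<open>a_0 b = L(-1)(ab)/2\<close> (\<open>mode_0_eq\<close>). The commutator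
  \<open>[a_0, b_n] = (a_0 b)_n\<close> thus equals \<open>-(n/2) (ab)_(n-1)\<close>. Applied to \<open>c \<in> V_2\<close> with \<open>n = 2\<close> and
  \<open>n = 4\<close>, where \<open>b_n c = 0\<close>, and with \<open>a_0 c = L(-1)(ac)/2\<close>, it becomes
  \<open>(ab)_(n-1) c = b_(n-1) (ac)\<close> (\<open>product_mode\<close>). Together with commutativity, \<open>n = 2\<close> is
  associativity of the product and \<open>n = 4\<close> is associativity of the form.
\<close>

section \<open>Modes, commutators and weights\<close>

lemma Sum_any_eq_zeroth:
  fixes f :: "nat \<Rightarrow> 'a::comm_monoid_add"
  assumes "\<And>i. i > 0 \<Longrightarrow> f i = 0"
  shows "Sum_any f = f 0"
proof -
  have "Sum_any f = sum f {0}"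
    by (rule Sum_any.expand_superset) (use assms in auto)
  then show ?thesis by simp
qed

context conformal_vertex_superalgebra
begin

abbreviation wtspace :: "rat \<Rightarrow> 'v set" where
  "wtspace \<equiv> weight_space scale Y \<omega>"

abbreviation L :: "int \<Rightarrow> 'v \<Rightarrow> 'v" where
  "L \<equiv> virasoro Y \<omega>"

lemma Y_mode_linear [simp]:
  "Y u n (v + w) = Y u n v + Y u n w" "Y u n (v - w) = Y u n v - Y u n w"
  "Y u n (scale c v) = scale c (Y u n v)" "Y u n 0 = 0" "Y u n (- v) = - Y u n v"
proof -
  interpret l: Vector_Spaces.linear scale scale "Y u n" by (rule mode_linear)
  show "Y u n (v + w) = Y u n v + Y u n w" "Y u n (v - w) = Y u n v - Y u n w"
    "Y u n (scale c v) = scale c (Y u n v)" "Y u n 0 = 0" "Y u n (- v) = - Y u n v"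
    by (simp_all add: l.add l.diff l.scale l.neg)
qed

lemma Y_state_linear [simp]:
  "Y (u + v) n w = Y u n w + Y v n w" "Y (u - v) n w = Y u n w - Y v n w"
  "Y (scale c u) n w = scale c (Y u n w)" "Y 0 n w = 0" "Y (- u) n w = - Y u n w"
proof -
  interpret l: Vector_Spaces.linear scale scale "\<lambda>u. Y u n w" by (rule Y_linear)
  show "Y (u + v) n w = Y u n w + Y v n w" "Y (u - v) n w = Y u n w - Y v n w"
    "Y (scale c u) n w = scale c (Y u n w)" "Y 0 n w = 0" "Y (- u) n w = - Y u n w"
    by (simp_all add: l.add l.diff l.scale l.neg)
qed

lemma L_linear [simp]:
  "L n (v + w) = L n v + L n w" "L n (v - w) = L n v - L n w"
  "L n (scale c v) = scale c (L n v)" "L n 0 = 0" "L n (- v) = - L n v"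
  by (simp_all add: virasoro_def)

lemma mem_wtspace: "v \<in> wtspace q \<longleftrightarrow> L 0 v = scale (of_rat q) v"
  by (simp add: weight_space_def)

lemma subspace_wtspace: "subspace (wtspace q)"
  by (rule subspaceI) (auto simp: mem_wtspace scale_right_distrib mult.commute)

lemma zero_mem_wtspace [simp]: "0 \<in> wtspace q"
  by (simp add: mem_wtspace)

lemma wtspace_int_even: "wtspace (of_int n) \<subseteq> parity_space scale Y \<omega> 0"
  unfolding parity_space_def by (auto intro!: span_base)

lemma wtspace_half_odd: "wtspace (of_int n + 1/2) \<subseteq> parity_space scale Y \<omega> 1"
  unfolding parity_space_def by (auto intro!: span_base)

lemma wtspace_2_even: "v \<in> wtspace 2 \<Longrightarrow> v \<in> parity_space scale Y \<omega> 0"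
  using wtspace_int_even[of 2] by auto

lemma wtspace_3_halves_odd: "v \<in> wtspace (3/2) \<Longrightarrow> v \<in> parity_space scale Y \<omega> 1"
  using wtspace_half_odd[of 1] by auto

lemma vac_nonzero: "vac \<noteq> 0"
proof
  assume "vac = 0"
  then have "v = 0" for v :: 'v
    using vac_mode[of "-1" v] by simp
  with nonzero show False by blast
qed

lemma L_vac: "n \<ge> -1 \<Longrightarrow> L n vac = 0"
  by (simp add: virasoro_def creation_nonneg)

lemma vac_weight: "vac \<in> wtspace 0"
  by (simp add: mem_wtspace L_vac)

text \<open>Since \<open>L(0)\<close> kills the vacuum, this is \<open>[L(0), L(-2)] = 2 L(-2)\<close> applied to it.\<close>

lemma conformal_weight: "\<omega> \<in> wtspace 2"
proof -
  obtain c where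
    "L 0 (L (-2) vac) - L (-2) (L 0 vac) = scale (of_int (0 - (-2))) (L (0 + (-2)) vac)
      + scale (of_int (0 ^ 3 - 0) / 12 * (if 0 + (-2) = (0::int) then 1 else 0) * c) vac"
    using virasoro_relations by blast
  moreover have "L (-2) vac = \<omega>"
    by (simp add: virasoro_def creation)
  ultimately show ?thesis
    by (simp add: mem_wtspace L_vac)
qed

text \<open>
  The Jacobi identity at \<open>m = 0\<close>: the binomials \<open>0 choose i\<close> leave only the first term on the
  left, and \<open>k \<ge> 0\<close> makes the right-hand side a finite sum whatever the truncation bound is.
\<close>

lemma commutator_formula:
  assumes u: "u \<in> parity_space scale Y \<omega> \<alpha>" and v: "v \<in> parity_space scale Y \<omega> \<beta>"
  shows "Y u (int k) (Y v n w) - scale (super_sign \<alpha> \<beta>) (Y v n (Y u (int k) w))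
         = (\<Sum>i\<le>k. scale (of_nat (k choose i)) (Y (Y u (int i) v) (n + int k - int i) w))"
proof -
  let ?l = "\<lambda>i::nat. scale ((-1) ^ i * (of_int 0 gchoose i))
             (Y u (0 + int k - int i) (Y v (n + int i) w)
              - scale (super_sign \<alpha> \<beta> * (-1) powi 0)
                  (Y v (0 + n - int i) (Y u (int k + int i) w)))"
  let ?r = "\<lambda>i::nat. scale (of_int (int k) gchoose i)
             (Y (Y u (0 + int i) v) (n + int k - int i) w)"
  have "Sum_any ?l = Sum_any ?r"
    by (rule jacobi[OF u v])
  moreover have "Sum_any ?l = ?l 0"
    by (rule Sum_any_eq_zeroth) (simp add: gbinomial_0_left)
  moreover have "Sum_any ?r = sum ?r {..k}"
    by (rule Sum_any.expand_superset)
      (auto simp: binomial_gbinomial[symmetric] intro: ccontr)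
  ultimately show ?thesis
    by (simp add: binomial_gbinomial)
qed

lemma even_commutator:
  assumes "u \<in> parity_space scale Y \<omega> 0" and "v \<in> parity_space scale Y \<omega> \<beta>"
  shows "Y u (int k) (Y v n w) - Y v n (Y u (int k) w)
         = (\<Sum>i\<le>k. scale (of_nat (k choose i)) (Y (Y u (int i) v) (n + int k - int i) w))"
  using commutator_formula[OF assms, of k n w] by (simp add: super_sign_def)

text \<open>
  Brackets of \<open>L(-1) = \<omega>_0\<close>, \<open>L(0) = \<omega>_1\<close>, \<open>L(1) = \<omega>_2\<close> with a mode. The terms containing
  \<open>(L(-1)v)_n\<close> are rewritten by the translation axiom.
\<close>

lemma L_minus_1_commutator:
  assumes "v \<in> parity_space scale Y \<omega> \<beta>"
  shows "L (-1) (Y v n w) = Y v n (L (-1) w) - scale (of_int n) (Y v (n - 1) w)"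
  using even_commutator[OF conformal_even assms, of 0 n w] translation[of v n w]
  by (simp add: virasoro_def algebra_simps)

lemma L_0_commutator:
  assumes "v \<in> parity_space scale Y \<omega> \<beta>"
  shows "L 0 (Y v n w) = Y v n (L 0 w) + Y (L 0 v) n w - scale (of_int (n + 1)) (Y v n w)"
  using even_commutator[OF conformal_even assms, of 1 n w] translation[of v "n+1" w]
  by (simp add: virasoro_def algebra_simps)

lemma L_1_commutator:
  assumes "v \<in> parity_space scale Y \<omega> \<beta>"
  shows "L 1 (Y v n w) = Y v n (L 1 w) - scale (of_int (n + 2)) (Y v (n + 1) w)
           + scale 2 (Y (L 0 v) (n + 1) w) + Y (L 1 v) n w"
proof -
  have "Y \<omega> 2 (Y v n w) - Y v n (Y \<omega> 2 w)
      = (\<Sum>i\<le>2. scale (of_nat (2 choose i)) (Y (Y \<omega> (int i) v) (n + int 2 - int i) w))"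
    using even_commutator[OF conformal_even assms, of 2 n w] by simp
  also have "\<dots> = Y (Y \<omega> 0 v) (n + 2) w + scale 2 (Y (Y \<omega> 1 v) (n + 1) w) + Y (Y \<omega> 2 v) n w"
    by (simp add: numeral_2_eq_2 algebra_simps)
  finally show ?thesis
    using translation[of v "n+2" w] by (simp add: virasoro_def algebra_simps)
qed

lemma mode_weight:
  assumes "v \<in> parity_space scale Y \<omega> \<beta>" "v \<in> wtspace p" "w \<in> wtspace q"
    and "r = p + q - of_int n - 1"
  shows "Y v n w \<in> wtspace r"
proof -
  have "L 0 (Y v n w) = scale (of_rat q) (Y v n w) + scale (of_rat p) (Y v n w)
          - scale (of_int (n + 1)) (Y v n w)"
    using L_0_commutator[OF assms(1), of n w] assms(2,3) by (simp add: mem_wtspace)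
  also have "\<dots> = scale (of_rat q + of_rat p - of_int (n + 1)) (Y v n w)"
    by (simp only: scale_left_distrib scale_left_diff_distrib)
  also have "of_rat q + of_rat p - of_int (n + 1) = (of_rat r :: complex)"
    unfolding assms(4) by (simp add: of_rat_add of_rat_diff)
  finally show ?thesis
    by (simp add: mem_wtspace)
qed

text \<open>
  The Jacobi identity at \<open>n = 0\<close>, \<open>k = -1\<close>, applied to the vacuum: there \<open>v_i\<close> annihilates the
  vacuum for all \<open>i \<ge> 0\<close>, and \<open>u_(-1+i)\<close> does so for all \<open>i > 0\<close>. By the creation and
  translation axioms, \<open>x_(-1-i)\<close> applied to the vacuum is \<open>L(-1)^i x / i!\<close>, so this is the usual
  skew-symmetry formula.
\<close>

lemma even_skew_symmetry:
  assumes u: "u \<in> parity_space scale Y \<omega> 0" and v: "v \<in> parity_space scale Y \<omega> 0"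
  shows "scale (- ((-1) powi m)) (Y v m u)
         = Sum_any (\<lambda>i. scale ((-1) ^ i) (Y (Y u (m + int i) v) (- 1 - int i) vac))"
proof -
  let ?l = "\<lambda>i::nat. scale ((-1) ^ i * (of_int m gchoose i))
             (Y u (m + (-1) - int i) (Y v (0 + int i) vac)
              - scale (super_sign 0 0 * (-1) powi m)
                  (Y v (m + 0 - int i) (Y u (-1 + int i) vac)))"
  have "Sum_any ?l = Sum_any (\<lambda>i. scale (of_int (-1) gchoose i)
             (Y (Y u (m + int i) v) (0 + (-1) - int i) vac))"
    by (rule jacobi[OF u v])
  moreover have "Sum_any ?l = ?l 0"
    by (rule Sum_any_eq_zeroth) (simp add: creation_nonneg)
  moreover have "(- 1 :: complex) gchoose i = (-1) ^ i" for i
    using gbinomial_minus[of "1::complex" i] by (simp add: pochhammer_fact[symmetric] gbinomial_pochhammer')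
  ultimately show ?thesis
    by (simp add: creation creation_nonneg super_sign_def)
qed

section \<open>Strong generation and the low weights\<close>

lemma span_family_decomposition:
  fixes W :: "rat \<Rightarrow> 'v set"
  assumes W: "\<And>q. subspace (W q)" and x: "x \<in> span (\<Union>q\<in>I. W q)"
  shows "\<exists>f. (\<forall>q\<in>I. f q \<in> W q) \<and> (\<forall>q. q \<notin> I \<longrightarrow> f q = 0) \<and> finite {q. f q \<noteq> 0} \<and> x = Sum_any f"
  using x
proof (induction rule: span_induct_alt)
  case base
  show ?case
    using W by (intro exI[of _ "\<lambda>_. 0"]) (auto simp: subspace_0)
next
  case (step c x y)
  obtain p where p: "p \<in> I" "x \<in> W p" using step(1) by blast
  obtain f where f: "\<forall>q\<in>I. f q \<in> W q" "\<forall>q. q \<notin> I \<longrightarrow> f q = 0"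
    "finite {q. f q \<noteq> 0}" "y = Sum_any f"
    using step(2) by blast
  let ?e = "\<lambda>q. if q = p then scale c x else 0"
  have e: "finite {q. ?e q \<noteq> 0}" "Sum_any ?e = scale c x"
    by (auto intro: finite_subset[of _ "{p}"])
  show ?case
  proof (intro exI conjI)
    show "\<forall>q\<in>I. ?e q + f q \<in> W q"
      using f(1) p W by (auto intro: subspace_add subspace_scale subspace_0)
    show "\<forall>q. q \<notin> I \<longrightarrow> ?e q + f q = 0"
      using f(2) p by auto
    show "finite {q. ?e q + f q \<noteq> 0}"
      by (rule finite_subset[of _ "{q. ?e q \<noteq> 0} \<union> {q. f q \<noteq> 0}"]) (use e(1) f(3) in auto)
    show "scale c x + y = Sum_any (\<lambda>q. ?e q + f q)"
      using Sum_any.distrib[OF e(1) f(3)] e(2) f(4) by simp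
  qed
qed

text \<open>
  A vector of weight \<open>q\<close> decomposes along the \<open>W\<close>'s and also as the single term of weight \<open>q\<close>.
  Both are decompositions for the grading, so uniqueness puts the vector in \<open>W q\<close>.
\<close>

lemma spanning_family_exhausts_weights:
  assumes W: "\<And>q. subspace (W q)" "\<And>q. W q \<subseteq> wtspace q"
    and span: "span (\<Union>q\<in>half_integers. W q) = UNIV" and q: "q \<in> half_integers"
  shows "wtspace q \<subseteq> W q"
proof
  fix x assume x: "x \<in> wtspace q"
  obtain f where f: "\<forall>q\<in>half_integers. f q \<in> W q" "\<forall>q. q \<notin> half_integers \<longrightarrow> f q = 0"
    "finite {q. f q \<noteq> 0}" "x = Sum_any f"
    using span_family_decomposition[of W x half_integers, OF W(1)] span by auto
  let ?e = "\<lambda>r. if r = q then x else 0"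
  let ?D = "\<lambda>g. (\<forall>r\<in>half_integers. g r \<in> wtspace r) \<and> (\<forall>r. r \<notin> half_integers \<longrightarrow> g r = 0)
      \<and> finite {r. g r \<noteq> 0} \<and> x = Sum_any g"
  have "?D f"
    using f W(2) by blast
  moreover have "?D ?e"
    using x q by (auto intro: finite_subset[of _ "{q}"])
  moreover have "\<exists>!g. ?D g"
    using grading unfolding is_direct_sum_def by (rule spec)
  ultimately have "f = ?e"
    using the1_equality[of ?D f] the1_equality[of ?D ?e] by simp
  then have "f q = x" by simp
  then show "x \<in> W q" using f(1) q by auto
qed

end

locale weight_3_halves_2_generated = conformal_vertex_superalgebra +
  assumes generated:
    "strongly_generates scale Y vac {a + b | a b. a \<in> wtspace (3/2) \<and> b \<in> wtspace 2}"
begin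

text \<open>
  An upper bound for the vectors of weight \<open>q\<close> that products of creation modes of generators can
  produce: the empty product gives the vacuum, and every other product has weight at least \<open>3/2\<close>.
\<close>

definition attainable :: "rat \<Rightarrow> 'a set" where
  "attainable q =
     (if q = 0 then span {vac} else if q \<ge> 3/2 then wtspace q else {0})"

lemma subspace_attainable: "subspace (attainable q)"
  by (simp add: attainable_def subspace_wtspace)

lemma attainable_subset: "attainable q \<subseteq> wtspace q"
  using span_minimal[OF _ subspace_wtspace, of "{vac}" 0] vac_weight
  by (auto simp: attainable_def)

lemma attainable_large: "q \<ge> 3/2 \<Longrightarrow> attainable q = wtspace q"
  by (simp add: attainable_def)

lemma half_integer_shift: "q \<in> half_integers \<Longrightarrow> q + of_int n / 2 \<in> half_integers"
proof -
  assume "q \<in> half_integers"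
  then obtain k :: int where "q = of_int k / 2" by (auto simp: half_integers_def)
  then have "q + of_int n / 2 = of_int (k + n) / 2" by (simp add: add_divide_distrib)
  then show ?thesis unfolding half_integers_def by blast
qed

text \<open>
  The span contains the vacuum and is stable under every creation mode of a generator, because
  such a mode raises weights by at least \<open>3/2\<close>. Hence it contains all the spanning monomials.
\<close>

lemma attainable_spans: "span (\<Union>q\<in>half_integers. attainable q) = UNIV"
proof -
  let ?B = "\<Union>q\<in>half_integers. attainable q"
  have zero: "0 \<in> half_integers"
    unfolding half_integers_def by (rule image_eqI[of _ _ 0]) auto
  have vac: "vac \<in> span ?B"
    by (rule span_base) (use zero in \<open>auto simp: attainable_def intro!: bexI[of _ 0] span_base\<close>)
  \<comment> \<open>A generator is a sum of vectors of weights \<open>3/2\<close> and \<open>2\<close>, of opposite parity. The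
    weight formula needs homogeneous vectors, so each summand is treated separately.\<close>
  have homogeneous: "Y a (- n) w \<in> span ?B"
    if n: "n > 0" and a: "a \<in> parity_space scale Y \<omega> \<beta>" "a \<in> wtspace (of_int k / 2)" "k \<ge> 3"
      and w: "w \<in> span ?B" for a n w \<beta> k
    using w
  proof (induction rule: span_induct_alt)
    case base
    show ?case by (simp add: span_zero)
  next
    case (step c x y)
    obtain q where q: "q \<in> half_integers" "x \<in> attainable q" using step(1) by blast
    show ?case
    proof (cases "q \<ge> 0")
      case True
      let ?r = "q + of_int (k + 2 * n - 2) / 2"
      have "Y a (- n) x \<in> wtspace ?r"
        by (rule mode_weight[OF a(1,2)])
          (use q(2) attainable_subset in \<open>auto simp: field_simps\<close>)
      moreover have "?r \<ge> 3/2"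
      proof -
        have "3 \<le> k + 2 * n - 2" using a(3) n by linarith
        then have "(of_int 3 :: rat) \<le> of_int (k + 2 * n - 2)" by (simp only: of_int_le_iff)
        then have "(3/2 :: rat) \<le> of_int (k + 2 * n - 2) / 2" by (simp del: of_int_add of_int_diff)
        then show ?thesis using True by linarith
      qed
      ultimately have "Y a (- n) x \<in> attainable ?r"
        by (simp only: attainable_large)
      then have "Y a (- n) x \<in> span ?B"
        using half_integer_shift[OF q(1)] by (intro span_base) blast
      then show ?thesis
        using step(2) by (simp add: span_add span_scale)
    next
      case False
      then have "x = 0" using q(2) by (simp add: attainable_def)
      then show ?thesis using step(2) by simp
    qed
  qed
  have monomial: "foldr (\<lambda>(a, n). Y a (- n)) xs vac \<in> span ?B"
    if "\<forall>(a, n)\<in>set xs. a \<in> {a + b | a b. a \<in> wtspace (3/2) \<and> b \<in> wtspace 2} \<and> n > 0"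
    for xs :: "('a \<times> int) list"
    using that
  proof (induction xs)
    case Nil
    show ?case by (simp add: vac)
  next
    case (Cons p xs)
    obtain a n where p: "p = (a, n)" by (cases p)
    obtain x y where xy: "a = x + y" "x \<in> wtspace (3/2)" "y \<in> wtspace 2" "n > 0"
      using Cons.prems p by auto
    let ?w = "foldr (\<lambda>(a, n). Y a (- n)) xs vac"
    have "?w \<in> span ?B" using Cons by simp
    then have "Y x (- n) ?w \<in> span ?B" "Y y (- n) ?w \<in> span ?B"
      using homogeneous[of n x 1 3 ?w] homogeneous[of n y 0 4 ?w] xy
        wtspace_3_halves_odd wtspace_2_even by auto
    then show ?case
      by (simp add: p xy(1) span_add)
  qed
  have "span {foldr (\<lambda>(a, n). Y a (- n)) xs vac | xs :: ('a \<times> int) list.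
          \<forall>(a, n)\<in>set xs. a \<in> {a + b | a b. a \<in> wtspace (3/2) \<and> b \<in> wtspace 2} \<and> n > 0}
        \<subseteq> span ?B"
    by (rule span_minimal) (use monomial in auto)
  then show ?thesis
    using generated unfolding strongly_generates_def by blast
qed

lemma weight_0: "v \<in> wtspace 0 \<Longrightarrow> \<exists>c. v = scale c vac"
  using spanning_family_exhausts_weights[OF subspace_attainable attainable_subset
      attainable_spans, of 0]
  by (auto simp: attainable_def half_integers_def span_singleton intro: image_eqI[of _ _ 0])

lemma weight_gap:
  assumes "v \<in> wtspace (of_int n)" "n \<le> 1" "n \<noteq> 0"
  shows "v = 0"
proof -
  have "of_int n \<in> half_integers"
    unfolding half_integers_def by (rule image_eqI[of _ _ "2 * n"]) auto
  moreover have "\<not> (3/2 \<le> (of_int n :: rat))"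
    using assms(2) by linarith
  ultimately show ?thesis
    using spanning_family_exhausts_weights[OF subspace_attainable attainable_subset
      attainable_spans, of "of_int n"] assms
    by (auto simp: attainable_def)
qed

section \<open>The commutative algebra of weight 2\<close>

lemma weight_2_mode:
  assumes "a \<in> wtspace 2" "v \<in> wtspace 2"
  shows "Y a n v \<in> wtspace (of_int (3 - n))"
  by (rule mode_weight[OF wtspace_2_even[OF assms(1)] assms]) simp

lemma weight_2_mode_eq_0:
  assumes "a \<in> wtspace 2" "v \<in> wtspace 2" "n = 2 \<or> n \<ge> 4"
  shows "Y a n v = 0"
  by (rule weight_gap[OF weight_2_mode[OF assms(1,2)]]) (use assms(3) in auto)

lemma product_closed: "a \<in> wtspace 2 \<Longrightarrow> b \<in> wtspace 2 \<Longrightarrow> Y a 1 b \<in> wtspace 2"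
  using weight_2_mode[of a b 1] by simp

text \<open>Existence of the coefficient is \<open>weight_0\<close>; uniqueness holds because the vacuum is nonzero.\<close>

lemma form_eq:
  assumes "a \<in> wtspace 2" "b \<in> wtspace 2"
  shows "Y a 3 b = scale (weight2_form scale Y vac a b) vac"
proof -
  obtain c where c: "Y a 3 b = scale c vac"
    using weight_0[of "Y a 3 b"] weight_2_mode[OF assms, of 3] by auto
  have "weight2_form scale Y vac a b = c"
    unfolding weight2_form_def c using vac_nonzero by (intro the_equality) auto
  then show ?thesis using c by simp
qed

lemma form_eqI:
  "a \<in> wtspace 2 \<Longrightarrow> b \<in> wtspace 2 \<Longrightarrow> Y a 3 b = scale c vac \<Longrightarrow> weight2_form scale Y vac a b = c"
  using form_eq[of a b] vac_nonzero by simp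

text \<open>
  In the skew-symmetry formula a correction term with \<open>m + i = 3\<close> is a mode of a multiple of the
  vacuum, and \<open>vac_(-1-i)\<close> is zero for \<open>i > 0\<close>. In all other correction terms \<open>m + i\<close> is \<open>2\<close>
  or at least \<open>4\<close>, and \<open>a_(m+i) b\<close> is zero by weight. Finally \<open>-(-1)^m = 1\<close> for odd \<open>m\<close>.
\<close>

lemma skew_symmetry_weight_2:
  assumes a: "a \<in> wtspace 2" and b: "b \<in> wtspace 2" and m: "m = 1 \<or> m = 3"
  shows "Y b m a = Y a m b"
proof -
  have "Y (Y a (m + int i) b) (- 1 - int i) vac = 0" if "i > 0" for i
  proof (cases "m + int i = 3")
    case True
    then show ?thesis using form_eq[OF a b] that by (simp add: vac_mode)
  next
    case False
    then have "Y a (m + int i) b = 0"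
      using m that by (intro weight_2_mode_eq_0[OF a b]) auto
    then show ?thesis by simp
  qed
  then have "scale (- ((-1) powi m)) (Y b m a) = Y (Y a m b) (- 1) vac"
    unfolding even_skew_symmetry[OF wtspace_2_even[OF a] wtspace_2_even[OF b]]
    by (subst Sum_any_eq_zeroth) auto
  then show ?thesis using m by (auto simp: creation)
qed

lemma conformal_half_identity:
  assumes "a \<in> wtspace 2"
  shows "Y (scale (1/2) \<omega>) 1 a = a"
  using assms by (simp add: mem_wtspace virasoro_def)

section \<open>Associativity\<close>

context
  assumes translation_valued: "\<And>a b. a \<in> wtspace 2 \<Longrightarrow> b \<in> wtspace 2 \<Longrightarrow> Y a 0 b \<in> L (-1) ` wtspace 2"
begin

text \<open>
  The operator \<open>L(1)\<close> recovers \<open>x\<close> from \<open>a_0 b = L(-1)x\<close>: as \<open>L(1)\<close> kills \<open>V_2\<close>, the left side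
  gives \<open>[L(1), a_0] b = 2 a_1 b\<close> and the right side gives \<open>2 L(0)x = 4x\<close>.
\<close>

lemma mode_0_eq:
  assumes a: "a \<in> wtspace 2" and b: "b \<in> wtspace 2"
  shows "Y a 0 b = scale (1/2) (L (-1) (Y a 1 b))"
proof -
  obtain x where x: "x \<in> wtspace 2" "Y a 0 b = L (-1) x"
    using translation_valued[OF a b] by blast
  have L1: "L 1 v = 0" if "v \<in> wtspace 2" for v
    using weight_2_mode_eq_0[OF conformal_weight that, of 2] by (simp add: virasoro_def)
  have L0: "L 0 v = scale 2 v" if "v \<in> wtspace 2" for v
    using that by (simp add: mem_wtspace)
  have "L 1 (Y a 0 b) = scale 2 (Y a 1 b)"
    using L_1_commutator[OF wtspace_2_even[OF a], of 0 b] 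
    by (simp add: L1 L0 a b scale_left_diff_distrib[symmetric])
  moreover have "L 1 (L (-1) x) = scale 4 x"
  proof -
    obtain c where
      "L 1 (L (-1) x) - L (-1) (L 1 x) = scale (of_int (1 - (-1))) (L (1 + (-1)) x)
        + scale (of_int (1 ^ 3 - 1) / 12 * (if 1 + (-1) = (0::int) then 1 else 0) * c) x"
      using virasoro_relations by blast
    then show ?thesis by (simp add: L1 L0 x(1))
  qed
  ultimately have "scale (1/4) (scale 4 x) = scale (1/4) (scale 2 (Y a 1 b))"
    using x(2) by simp
  then have "x = scale (1/2) (Y a 1 b)" by simp
  then show ?thesis using x(2) by simp
qed

text \<open>
  This is \<open>[a_0, b_n] c = (a_0 b)_n c\<close> with both \<open>a_0 b\<close> and \<open>a_0 c\<close> replaced by translates of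
  products. Both sides acquire the factor \<open>-n/2\<close>, from the translation axiom on the right and from
  \<open>[L(-1), b_n] = -n b_(n-1)\<close> on the left. For \<open>n = 2\<close> and \<open>n = 4\<close> every \<open>b_n\<close> kills \<open>V_2\<close>.
\<close>

lemma product_mode:
  assumes a: "a \<in> wtspace 2" and b: "b \<in> wtspace 2" and c: "c \<in> wtspace 2"
    and n: "n = 2 \<or> n = 4"
  shows "Y (Y a 1 b) (n - 1) c = Y b (n - 1) (Y a 1 c)"
proof -
  have "Y a 0 (Y b n c) - Y b n (Y a 0 c) = Y (Y a 0 b) n c"
    using even_commutator[OF wtspace_2_even[OF a] wtspace_2_even[OF b], of 0 n c] by simp
  moreover have "Y b n c = 0"
    using n by (intro weight_2_mode_eq_0[OF b c]) auto
  moreover have "Y (Y a 0 b) n c = scale (- of_int n / 2) (Y (Y a 1 b) (n - 1) c)"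
    using translation[of "Y a 1 b" n c] by (simp add: mode_0_eq[OF a b])
  moreover have "Y b n (Y a 0 c) = scale (of_int n / 2) (Y b (n - 1) (Y a 1 c))"
  proof -
    have "Y b n (Y a 1 c) = 0"
      using n by (intro weight_2_mode_eq_0[OF b product_closed[OF a c]]) auto
    then have "Y b n (L (-1) (Y a 1 c)) = scale (of_int n) (Y b (n - 1) (Y a 1 c))"
      using L_minus_1_commutator[OF wtspace_2_even[OF b], of n "Y a 1 c"] by simp
    then show ?thesis by (simp add: mode_0_eq[OF a c])
  qed
  ultimately have "scale (of_int n / 2) (Y b (n - 1) (Y a 1 c))
      = scale (of_int n / 2) (Y (Y a 1 b) (n - 1) c)"
    by simp
  then show ?thesis using n by auto
qed

lemma product_assoc:
  assumes a: "a \<in> wtspace 2" and b: "b \<in> wtspace 2" and c: "c \<in> wtspace 2"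
  shows "Y (Y a 1 b) 1 c = Y a 1 (Y b 1 c)"
  using product_mode[OF b a c, of 2] skew_symmetry_weight_2[OF a b, of 1] by simp

lemma form_assoc:
  assumes a: "a \<in> wtspace 2" and b: "b \<in> wtspace 2" and c: "c \<in> wtspace 2"
  shows "Y (Y a 1 b) 3 c = Y a 3 (Y b 1 c)"
  using product_mode[OF b a c, of 4] skew_symmetry_weight_2[OF a b, of 1] by simp

end

end

theorem proposition3p9:
  fixes scale :: "complex \<Rightarrow> 'v::ab_group_add \<Rightarrow> 'v"
    and Y :: "'v modes" and vac \<omega> :: 'v
  defines "wt \<equiv> weight_space scale Y \<omega>"
    and "mult \<equiv> weight2_product Y"
    and "form \<equiv> weight2_form scale Y vac"
  assumes V: "conformal_vertex_superalgebra scale Y vac \<omega>"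
    and gen: "strongly_generates scale Y vac {a + b | a b. a \<in> wt (3/2) \<and> b \<in> wt 2}"
  shows "nonassociative_algebra_on scale (wt 2) mult \<and>
         (\<forall>a\<in>wt 2. \<forall>b\<in>wt 2. Y a 3 b = scale (form a b) vac) \<and>
         bilinear_on scale (*) (wt 2) form \<and>
         (\<forall>a\<in>wt 2. \<forall>b\<in>wt 2. mult a b = mult b a) \<and>
         scale (1/2) \<omega> \<in> wt 2 \<and>
         (\<forall>a\<in>wt 2. mult (scale (1/2) \<omega>) a = a \<and> mult a (scale (1/2) \<omega>) = a) \<and>
         (\<forall>a\<in>wt 2. \<forall>b\<in>wt 2. form a b = form b a) \<and>
         ((\<forall>a\<in>wt 2. \<forall>b\<in>wt 2. Y a 0 b \<in> virasoro Y \<omega> (-1) ` wt 2) \<longrightarrow>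
         (\<forall>a\<in>wt 2. \<forall>b\<in>wt 2. \<forall>c\<in>wt 2. mult (mult a b) c = mult a (mult b c)) \<and>
         (\<forall>a\<in>wt 2. \<forall>b\<in>wt 2. \<forall>c\<in>wt 2. form (mult a b) c = form a (mult b c)))"
proof -
  interpret weight_3_halves_2_generated scale Y vac \<omega>
    using V gen unfolding wt_def
    by (simp add: weight_3_halves_2_generated_def weight_3_halves_2_generated_axioms_def)
  note [simp] = subspace_add[OF subspace_wtspace] subspace_scale[OF subspace_wtspace]
  have half: "scale (1/2) \<omega> \<in> wtspace 2"
    by (simp add: conformal_weight)
  have comm: "Y a 1 b = Y b 1 a" "weight2_form scale Y vac a b = weight2_form scale Y vac b a"
    if "a \<in> wtspace 2" "b \<in> wtspace 2" for a b
    using skew_symmetry_weight_2[OF that] form_eqI[OF that] form_eq[OF that(2,1)] by auto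
  have alg: "nonassociative_algebra_on scale (wtspace 2) (weight2_product Y)"
    by (simp add: nonassociative_algebra_on_def bilinear_on_def weight2_product_def
        subspace_wtspace product_closed)
  have bil: "bilinear_on scale (*) (wtspace 2) (weight2_form scale Y vac)"
    unfolding bilinear_on_def
    by (auto intro!: form_eqI simp: form_eq scale_left_distrib)
  have unit: "Y (scale (1/2) \<omega>) 1 a = a" "Y a 1 (scale (1/2) \<omega>) = a" if "a \<in> wtspace 2" for a
    using conformal_half_identity[OF that] comm(1)[OF that half] by auto
  have assoc: "Y (Y a 1 b) 1 c = Y a 1 (Y b 1 c)"
    "weight2_form scale Y vac (Y a 1 b) c = weight2_form scale Y vac a (Y b 1 c)"
    if H: "\<forall>a\<in>wtspace 2. \<forall>b\<in>wtspace 2. Y a 0 b \<in> virasoro Y \<omega> (-1) ` wtspace 2"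
      and m: "a \<in> wtspace 2" "b \<in> wtspace 2" "c \<in> wtspace 2" for a b c
    using product_assoc[OF _ m] form_assoc[OF _ m] H
      form_eqI[OF product_closed[OF m(1,2)] m(3)] form_eq[OF m(1) product_closed[OF m(2,3)]]
    by auto
  show ?thesis
    unfolding wt_def mult_def form_def
    using alg bil half
    by (intro conjI impI ballI)
      (simp_all add: weight2_product_def form_eq[symmetric] comm(1) comm(2) unit assoc
        del: Y_mode_linear Y_state_linear)
qed

end
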